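(* Let $L > 0$, $R \ge 0$, $\epsilon \ge 0$, and let $f : \mathbb{R}^d \to \mathbb{R}$ be a convex, $L$-smooth function that attains its minimum and whose smallest-norm minimizer $w^*$ satisfies $\|w^*\| \le R$. For any real $\tau > 0$ with $\tau \ge 5\epsilon \|w^*\|$, algorithm AGP-opt, run with an arbitrary $\epsilon$-AGP oracle for $f$ and with parameter $$K = \min\Bigl\{ \frac{5 L R^2}{4\tau},\; \frac{L R}{4\epsilon} \Bigr\},$$ outputs a $w \in \mathbb{R}^d$ satisfying $f(w) \le f(w^* ) + \tau$. Furthermore, every point $w_k$ at which AGP-opt calls the oracle (Line 3) has norm at most $\frac{17}{8} R$. (When $\epsilon = 0$, $\frac{LR}{4\epsilon}$ is read as $+\infty$.)
   Context: All norms are Euclidean. A differentiable function is $L$-smooth if its gradient is $L$-Lipschitz. An $\epsilon$-AGP oracle for $f$ returns, when called with a point $w \in \mathbb{R}^d$, a vector $\mathrm{oracle}(w) \in \mathbb{R}^d$ with $\|\mathrm{oracle}(w) - \nabla f(w)\| \le \epsilon$; the returned vector is otherwise arbitrary (possibly adversarial). Algorithm AGP-opt$(K)$, for a real number $K$: Line 1: $w_0 \leftarrow \mathbf{0}$, $k \leftarrow 0$. Line 2: while $k < K$ do Lines 3–6: Line 3: $g_k \leftarrow \mathrm{oracle}(w_k)$. Line 4: if $\|g_k\| < 4\epsilon$ then return $w_k$ (and stop). Line 5: $w_{k+1} \leftarrow w_k - \frac{1}{2L} g_k$. Line 6: $k \leftarrow k+1$. Line 7 (after the loop): return $w_k$.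 *)

theory Defs
  imports "HOL-Analysis.Analysis"
begin

definition gradient :: "('a::euclidean_space \<Rightarrow> real) \<Rightarrow> 'a \<Rightarrow> 'a" where
  "gradient f x = (THE D. GDERIV f x :> D)"

definition smooth_with :: "real \<Rightarrow> ('a::euclidean_space \<Rightarrow> real) \<Rightarrow> bool" where
  "smooth_with L f \<longleftrightarrow>
     (\<forall>x. f differentiable (at x)) \<and> lipschitz_on L UNIV (gradient f)"

text \<open>
  An oracle need not answer repeated calls at the same point consistently, and it may adapt to
  earlier calls. The answer therefore depends on the number of the call (counted from 0) as well
  as on the point. Every answer sequence that can occur in a run of the deterministic algorithm
  below, even against an adaptive adversary, is produced by such an oracle.
\<close>

definition agp_oracle ::
    "real \<Rightarrow> ('a::euclidean_space \<Rightarrow> real) \<Rightarrow> (nat \<Rightarrow> 'a \<Rightarrow> 'a) \<Rightarrow> bool" where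
  "agp_oracle \<epsilon> f orc \<longleftrightarrow> (\<forall>k w. norm (orc k w - gradient f w) \<le> \<epsilon>)"

text \<open>
  The loop started in state \<open>(k, w)\<close>, where \<open>w\<close> is the current iterate. The result consists of the
  list of points at which the oracle is called from there on, and of the returned point.
\<close>

function agp_loop ::
    "real \<Rightarrow> real \<Rightarrow> (nat \<Rightarrow> 'a::euclidean_space \<Rightarrow> 'a) \<Rightarrow> real \<Rightarrow> nat \<Rightarrow> 'a \<Rightarrow> 'a list \<times> 'a"
where
  "agp_loop L \<epsilon> orc K k w =
     (if real k < K then
        (let g = orc k w in
         if norm g < 4 * \<epsilon> then ([w], w)
         else
           (let (qs, out) = agp_loop L \<epsilon> orc K (Suc k) (w - (1 / (2 * L)) *\<^sub>R g)
            in (w # qs, out)))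
      else ([], w))"
  by pat_completeness auto
termination
  by (relation "Wellfounded.measure (\<lambda>(L, \<epsilon>, orc, K, k, w). nat \<lceil>K\<rceil> - k)") (auto, linarith)

declare agp_loop.simps [simp del]

definition agp_queries ::
    "real \<Rightarrow> real \<Rightarrow> (nat \<Rightarrow> 'a::euclidean_space \<Rightarrow> 'a) \<Rightarrow> real \<Rightarrow> 'a set" where
  "agp_queries L \<epsilon> orc K = set (fst (agp_loop L \<epsilon> orc K 0 0))"

definition agp_opt ::
    "real \<Rightarrow> real \<Rightarrow> (nat \<Rightarrow> 'a::euclidean_space \<Rightarrow> 'a) \<Rightarrow> real \<Rightarrow> 'a" where
  "agp_opt L \<epsilon> orc K = snd (agp_loop L \<epsilon> orc K 0 0)"

text \<open>
  The second bound counts as \<open>\<infinity>\<close> for \<open>\<epsilon> = 0\<close>; division by zero in HOL would give \<open>0\<close> instead.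
\<close>

definition agp_budget :: "real \<Rightarrow> real \<Rightarrow> real \<Rightarrow> real \<Rightarrow> real" where
  "agp_budget L R \<epsilon> \<tau> =
     (if \<epsilon> = 0 then 5 * L * R\<^sup>2 / (4 * \<tau>)
      else min (5 * L * R\<^sup>2 / (4 * \<tau>)) (L * R / (4 * \<epsilon>)))"

definition min_norm_minimizer :: "('a::euclidean_space \<Rightarrow> real) \<Rightarrow> 'a" where
  "min_norm_minimizer f = arg_min norm (is_arg_min f (\<lambda>_. True))"

end

theory Submission
  imports Defs
begin

text \<open>
  Write \<open>D\<close> for the norm of the minimizer \<open>w\<^sup>*\<close>. An inexact step expands the distance to
  \<open>w\<^sup>*\<close> by at most \<open>\<epsilon> / (2 * L)\<close>, because the exact step is nonexpansive; with fewer than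
  \<open>L * R / (4 * \<epsilon>)\<close> steps the drift is at most \<open>R / 8\<close>, so \<open>\<parallel>w\<^sub>k\<parallel> \<le> R + (R + R / 8)\<close>. For the
  value, a step with \<open>\<parallel>g\<parallel> \<ge> 4 * \<epsilon>\<close> does not increase \<open>f\<close>, and as long as the gap exceeds \<open>\<tau>\<close>
  it decreases the squared distance to \<open>w\<^sup>*\<close> by at least \<open>4 * \<tau> / (5 * L)\<close>. Since \<open>\<tau> \<ge> 5 * \<epsilon> * D\<close>,
  both terms of the budget are at least \<open>5 * L * D\<^sup>2 / (4 * \<tau>)\<close>, so the gap cannot stay above
  \<open>\<tau>\<close> for the whole run. On an early stop the gap is at most \<open>5 * \<epsilon>\<close> times a distance that is
  still at most \<open>D\<close>.
\<close>

section \<open>Smooth convex functions\<close>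

text \<open>Riesz representation: the derivative is the inner product with
  \<open>adjoint f' 1\<close>. The representing vector is unique, so the \<open>THE\<close> in
  \<open>gradient\<close> denotes it.\<close>

lemma GDERIV_gradient:
  fixes f :: "'a::euclidean_space \<Rightarrow> real"
  assumes "f differentiable (at x)"
  shows "GDERIV f x :> gradient f x"
proof -
  obtain f' where f': "(f has_derivative f') (at x)"
    using assms by (auto simp: differentiable_def)
  interpret bounded_linear f' using f' by (rule has_derivative_bounded_linear)
  have "f' = (\<lambda>h. h \<bullet> adjoint f' 1)"
    using adjoint_works[OF linear_axioms, of _ 1] by (auto simp: fun_eq_iff)
  with f' have ex: "GDERIV f x :> adjoint f' 1"
    unfolding gderiv_def by metis
  have "D = E" if "GDERIV f x :> D" "GDERIV f x :> E" for D E
  proof -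
    have "(\<lambda>h. h \<bullet> D) = (\<lambda>h. h \<bullet> E)"
      using that unfolding gderiv_def by (rule has_derivative_unique)
    then show "D = E"
      by (metis vector_eq_ldot)
  qed
  with ex have "gradient f x = adjoint f' 1"
    unfolding gradient_def by (intro the_equality) blast+
  with ex show ?thesis by simp
qed

lemma gradient_eq_0_if_is_arg_min:
  fixes f :: "'a::euclidean_space \<Rightarrow> real"
  assumes "f differentiable (at x)" "is_arg_min f (\<lambda>_. True) x"
  shows "gradient f x = 0"
proof -
  have "(\<lambda>h. h \<bullet> gradient f x) = (\<lambda>h. 0)"
    using GDERIV_gradient[OF assms(1)] assms(2)
    unfolding gderiv_def
    by (intro has_derivative_local_min[of f _ x]) (auto simp: is_arg_min_linorder)
  then show ?thesis
    by (metis inner_eq_zero_iff)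
qed

lemma DERIV_along_line:
  fixes f :: "'a::euclidean_space \<Rightarrow> real"
  assumes "\<And>x. f differentiable (at x)"
  shows "((\<lambda>t. f (x + t *\<^sub>R d)) has_real_derivative (gradient f (x + t *\<^sub>R d) \<bullet> d)) (at t)"
proof -
  have "((\<lambda>t. f (x + t *\<^sub>R d)) has_derivative (\<lambda>s. (s *\<^sub>R d) \<bullet> gradient f (x + t *\<^sub>R d))) (at t)"
    by (rule has_derivative_compose[where g = f])
       (auto intro!: derivative_eq_intros GDERIV_gradient[unfolded gderiv_def] assms)
  then show ?thesis
    by (simp add: has_field_derivative_def inner_commute mult_commute_abs)
qed

text \<open>Restricting \<open>f\<close> to the line through \<open>x\<close> and \<open>y\<close>
  reduces this to the tangent inequality in one real variable.\<close>

lemma convex_on_above_gradient: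
  fixes f :: "'a::euclidean_space \<Rightarrow> real"
  assumes "\<And>x. f differentiable (at x)" "convex_on UNIV f"
  shows "f y \<ge> f x + gradient f x \<bullet> (y - x)"
proof -
  have "convex_on UNIV (\<lambda>t. f (x + t *\<^sub>R (y - x)))"
  proof (rule convex_onI)
    fix t a b :: real
    assume "0 < t" "t < 1"
    have eq: "x + ((1 - t) *\<^sub>R a + t *\<^sub>R b) *\<^sub>R (y - x) =
        (1 - t) *\<^sub>R (x + a *\<^sub>R (y - x)) + t *\<^sub>R (x + b *\<^sub>R (y - x))"
      by (simp add: algebra_simps)
    show "f (x + ((1 - t) *\<^sub>R a + t *\<^sub>R b) *\<^sub>R (y - x)) \<le>
        (1 - t) * f (x + a *\<^sub>R (y - x)) + t * f (x + b *\<^sub>R (y - x))"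
      unfolding eq using \<open>0 < t\<close> \<open>t < 1\<close> by (intro convex_onD[OF assms(2)]) auto
  qed simp
  from convex_on_imp_above_tangent[OF this, of 0 1] DERIV_along_line[OF assms(1), of x "y - x" 0]
  have "gradient f x \<bullet> (y - x) \<le> f y - f x" by auto
  then show ?thesis by simp
qed

lemma smooth_with_upper_bound:
  fixes f :: "'a::euclidean_space \<Rightarrow> real"
  assumes "smooth_with L f"
  shows "f (x + d) \<le> f x + gradient f x \<bullet> d + L / 2 * (norm d)\<^sup>2"
proof -
  have diff: "\<And>x. f differentiable (at x)" and lip: "lipschitz_on L UNIV (gradient f)"
    using assms by (auto simp: smooth_with_def)
  \<comment> \<open>\<open>h\<close> is \<open>f\<close> minus the linear and quadratic terms along
    the segment. The Lipschitz bound makes its derivative nonpositive, so monotonicity takes the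
    place of integration.\<close>
  define h where "h t = f (x + t *\<^sub>R d) - t * (gradient f x \<bullet> d) - L / 2 * t\<^sup>2 * (norm d)\<^sup>2" for t
  have "h 1 \<le> h 0"
  proof (rule DERIV_nonpos_imp_nonincreasing[where f = h])
    fix t :: real
    assume t: "0 \<le> t" "t \<le> 1"
    let ?h' = "gradient f (x + t *\<^sub>R d) \<bullet> d - gradient f x \<bullet> d - L * t * (norm d)\<^sup>2"
    have "(h has_real_derivative ?h') (at t)"
      unfolding h_def by (auto intro!: derivative_eq_intros DERIV_along_line diff)
    moreover have "?h' \<le> 0"
    proof -
      have "(gradient f (x + t *\<^sub>R d) - gradient f x) \<bullet> d
          \<le> norm (gradient f (x + t *\<^sub>R d) - gradient f x) * norm d"
        by (rule norm_cauchy_schwarz)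
      also have "\<dots> \<le> (L * norm (t *\<^sub>R d)) * norm d"
        using lipschitz_onD[OF lip, of "x + t *\<^sub>R d" x]
        by (intro mult_right_mono) (auto simp: dist_norm)
      finally show ?thesis
        using t by (simp add: inner_diff_left power2_eq_square mult_ac)
    qed
    ultimately show "\<exists>y. (h has_real_derivative y) (at t) \<and> y \<le> 0" by blast
  qed simp
  then show ?thesis by (simp add: h_def)
qed

text \<open>Sharpens the first-order convexity inequality by a squared gradient term, which later
  pays for the squared step length in the distance estimates.\<close>

lemma smooth_convex_gap_le:
  fixes f :: "'a::euclidean_space \<Rightarrow> real"
  assumes "L > 0" "smooth_with L f" "convex_on UNIV f" "is_arg_min f (\<lambda>_. True) v"
  shows "f w - f v + (norm (gradient f w))\<^sup>2 / (2 * L) \<le> gradient f w \<bullet> (w - v)"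
proof -
  have diff: "\<And>x. f differentiable (at x)"
    using assms by (auto simp: smooth_with_def)
  define G where "G = gradient f w"
  \<comment> \<open>Compare the tangent at \<open>w\<close> with the quadratic upper bound at \<open>v\<close>, in a gradient step from \<open>v\<close>
    for the function \<open>x \<mapsto> f x - G \<bullet> x\<close>, whose minimizer is \<open>w\<close>.\<close>
  define d where "d = (1 / L) *\<^sub>R G"
  have "f (v + d) \<ge> f w + G \<bullet> (v + d - w)"
    unfolding G_def by (rule convex_on_above_gradient[OF diff assms(3)])
  moreover have "f (v + d) \<le> f v + L / 2 * (norm d)\<^sup>2"
    using smooth_with_upper_bound[OF assms(2), of v d]
      gradient_eq_0_if_is_arg_min[OF diff assms(4)] by simp
  moreover have "G \<bullet> d = (norm G)\<^sup>2 / L" "L / 2 * (norm d)\<^sup>2 = (norm G)\<^sup>2 / (2 * L)"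
    using \<open>L > 0\<close> by (simp_all add: d_def dot_square_norm power_divide power2_eq_square)
  ultimately show ?thesis
    unfolding G_def[symmetric] by (simp add: inner_diff_right inner_add_right field_simps)
qed

text \<open>The minimizers form a closed sublevel set, so one of them is nearest to 0. This
  existence justifies the choice hidden in \<open>arg_min\<close>.\<close>

lemma is_arg_min_min_norm_minimizer:
  fixes f :: "'a::euclidean_space \<Rightarrow> real"
  assumes "continuous_on UNIV f" "\<exists>w. is_arg_min f (\<lambda>_. True) w"
  shows "is_arg_min f (\<lambda>_. True) (min_norm_minimizer f)"
proof -
  obtain w where w: "is_arg_min f (\<lambda>_. True) w" using assms(2) by blast
  let ?M = "Collect (is_arg_min f (\<lambda>_. True))"
  have "?M = {x. f x \<le> f w}"
    using w by (fastforce simp: is_arg_min_linorder intro: order_trans)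
  then have "closed ?M"
    using assms(1) by (simp add: closed_Collect_le)
  with w obtain x where "x \<in> ?M" "\<And>y. y \<in> ?M \<Longrightarrow> dist 0 x \<le> dist 0 y"
    using distance_attains_inf[of ?M 0] by blast
  then have "is_arg_min norm (is_arg_min f (\<lambda>_. True)) x"
    by (simp add: is_arg_min_linorder[of norm])
  then have "is_arg_min norm (is_arg_min f (\<lambda>_. True)) (min_norm_minimizer f)"
    unfolding min_norm_minimizer_def arg_min_def by (rule someI)
  then show ?thesis by (simp add: is_arg_min_def)
qed

section \<open>Inexact gradient steps\<close>

lemma norm_diff_step_sq:
  fixes w v g :: "'a::real_inner"
  assumes "L \<noteq> 0"
  shows "(norm (w - (1 / (2 * L)) *\<^sub>R g - v))\<^sup>2
    = (norm (w - v))\<^sup>2 - g \<bullet> (w - v) / L + (norm g)\<^sup>2 / (4 * L\<^sup>2)"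
proof -
  have "w - (1 / (2 * L)) *\<^sub>R g - v = (w - v) - (1 / (2 * L)) *\<^sub>R g" by simp
  then show ?thesis
    using assms
    by (simp only: power2_norm_eq_inner inner_diff_left inner_diff_right inner_scaleR_left
        inner_scaleR_right inner_commute)
       (simp add: field_simps power2_eq_square inner_commute)
qed

lemma inexact_step_dist:
  fixes f :: "'a::euclidean_space \<Rightarrow> real"
  assumes "L > 0" "smooth_with L f" "convex_on UNIV f" "is_arg_min f (\<lambda>_. True) v"
    and "norm (g - gradient f w) \<le> \<epsilon>"
  shows "norm (w - (1 / (2 * L)) *\<^sub>R g - v) \<le> norm (w - v) + \<epsilon> / (2 * L)"
proof -
  define G where "G = gradient f w"
  have "f w \<ge> f v" using assms(4) by (simp add: is_arg_min_linorder)
  with smooth_convex_gap_le[OF assms(1-4), of w]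
  have "(norm G)\<^sup>2 / (2 * L) \<le> G \<bullet> (w - v)" unfolding G_def by linarith
  then have "(norm G)\<^sup>2 / (2 * L) / L \<le> G \<bullet> (w - v) / L"
    using \<open>L > 0\<close> by (intro divide_right_mono) auto
  \<comment> \<open>The squared length of the exact step is at most half of the gain from the inner
    product.\<close>
  moreover have "(norm G)\<^sup>2 / (4 * L\<^sup>2) \<le> (norm G)\<^sup>2 / (2 * L) / L"
    using \<open>L > 0\<close> by (simp add: field_simps power2_eq_square)
  ultimately have "(norm (w - (1 / (2 * L)) *\<^sub>R G - v))\<^sup>2 \<le> (norm (w - v))\<^sup>2"
    using \<open>L > 0\<close> by (simp add: norm_diff_step_sq)
  then have exact: "norm (w - (1 / (2 * L)) *\<^sub>R G - v) \<le> norm (w - v)"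
    by (rule power2_le_imp_le) simp
  have "w - (1 / (2 * L)) *\<^sub>R g - v
      = (w - (1 / (2 * L)) *\<^sub>R G - v) - (1 / (2 * L)) *\<^sub>R (g - G)"
    by (simp add: algebra_simps)
  then have "norm (w - (1 / (2 * L)) *\<^sub>R g - v)
      \<le> norm (w - (1 / (2 * L)) *\<^sub>R G - v) + norm ((1 / (2 * L)) *\<^sub>R (g - G))"
    using norm_triangle_ineq4 by metis
  also have "norm ((1 / (2 * L)) *\<^sub>R (g - G)) \<le> \<epsilon> / (2 * L)"
    using assms(1,5) by (simp add: G_def divide_right_mono)
  finally show ?thesis using exact by linarith
qed

text \<open>The error is at most a quarter of \<open>norm g\<close>, so the linear term gains at
  least \<open>3 / (8 * L)\<close> times the square of \<open>norm g\<close>, against a quadratic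
  cost of \<open>1 / (8 * L)\<close> times it.\<close>

lemma inexact_step_descent:
  fixes f :: "'a::euclidean_space \<Rightarrow> real"
  assumes "L > 0" "smooth_with L f"
    and "norm (g - gradient f w) \<le> \<epsilon>" "4 * \<epsilon> \<le> norm g"
  shows "f (w - (1 / (2 * L)) *\<^sub>R g) \<le> f w"
proof -
  define e where "e = g - gradient f w"
  have "e \<bullet> g \<le> norm e * norm g" by (rule norm_cauchy_schwarz)
  also have "\<dots> \<le> norm g / 4 * norm g"
    using assms(3,4) by (intro mult_right_mono) (auto simp: e_def)
  finally have "gradient f w \<bullet> g \<ge> 3 / 4 * (norm g)\<^sup>2"
    by (simp add: e_def inner_diff_left dot_square_norm power2_eq_square)
  then have "gradient f w \<bullet> g / (2 * L) \<ge> 3 / 4 * (norm g)\<^sup>2 / (2 * L)"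
    using \<open>L > 0\<close> by (intro divide_right_mono) auto
  moreover have "f (w - (1 / (2 * L)) *\<^sub>R g) \<le>
      f w - gradient f w \<bullet> g / (2 * L) + L / 2 * ((norm g)\<^sup>2 / (2 * L)\<^sup>2)"
    using smooth_with_upper_bound[OF assms(2), of w "- (1 / (2 * L)) *\<^sub>R g"] \<open>L > 0\<close>
    by (simp add: power_divide power_mult_distrib)
  moreover have "L / 2 * ((norm g)\<^sup>2 / (2 * L)\<^sup>2) = (norm g)\<^sup>2 / (8 * L)"
    using \<open>L > 0\<close> by (simp add: field_simps power2_eq_square)
  moreover have "(norm g)\<^sup>2 / (8 * L) \<le> 3 / 4 * (norm g)\<^sup>2 / (2 * L)"
    using \<open>L > 0\<close> by (simp add: field_simps)
  ultimately show ?thesis by linarith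
qed

text \<open>The oracle error costs at most \<open>\<tau> / 5\<close> in the inner product with
  \<open>w - v\<close>, which leaves \<open>4 / 5 * \<tau>\<close> of the gap.\<close>

lemma inexact_step_progress:
  fixes f :: "'a::euclidean_space \<Rightarrow> real"
  assumes "L > 0" "smooth_with L f" "convex_on UNIV f" "is_arg_min f (\<lambda>_. True) v"
    and g: "norm (g - gradient f w) \<le> \<epsilon>" "4 * \<epsilon> \<le> norm g"
    and \<tau>: "5 * \<epsilon> * norm (w - v) \<le> \<tau>" "f w > f v + \<tau>"
  shows "(norm (w - (1 / (2 * L)) *\<^sub>R g - v))\<^sup>2 \<le> (norm (w - v))\<^sup>2 - 4 * \<tau> / (5 * L)"
proof -
  define G where "G = gradient f w"
  have "norm g \<le> norm G + norm (g - G)"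
    by (metis norm_triangle_sub)
  then have "3 / 4 * norm g \<le> norm G"
    using g by (simp add: G_def)
  then have "(3 / 4 * norm g)\<^sup>2 \<le> (norm G)\<^sup>2"
    by (intro power_mono) auto
  then have "9 / 16 * (norm g)\<^sup>2 \<le> (norm G)\<^sup>2"
    by (simp add: power_mult_distrib power_divide)
  \<comment> \<open>Weakening 9/16 to 1/2 produces exactly the term
    \<open>(norm g)\<^sup>2 / (4 * L\<^sup>2)\<close> that cancels in
    \<open>norm_diff_step_sq\<close>.\<close>
  then have "(norm g)\<^sup>2 / 2 \<le> (norm G)\<^sup>2"
    using zero_le_power2[of "norm g"] by linarith
  then have "(norm g)\<^sup>2 / 2 / (2 * L) \<le> (norm G)\<^sup>2 / (2 * L)"
    using \<open>L > 0\<close> by (intro divide_right_mono) auto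
  moreover have "\<bar>(g - G) \<bullet> (w - v)\<bar> \<le> norm (g - G) * norm (w - v)"
    by (rule Cauchy_Schwarz_ineq2)
  moreover have "norm (g - G) * norm (w - v) \<le> \<epsilon> * norm (w - v)"
    using g by (intro mult_right_mono) (auto simp: G_def)
  moreover have "f w - f v + (norm G)\<^sup>2 / (2 * L) \<le> G \<bullet> (w - v)"
    unfolding G_def by (rule smooth_convex_gap_le[OF assms(1-4)])
  moreover have "g \<bullet> (w - v) = G \<bullet> (w - v) + (g - G) \<bullet> (w - v)"
    by (simp add: inner_diff_left)
  ultimately have "4 / 5 * \<tau> + (norm g)\<^sup>2 / 2 / (2 * L) \<le> g \<bullet> (w - v)"
    using \<tau> by linarith
  then have "(4 / 5 * \<tau> + (norm g)\<^sup>2 / 2 / (2 * L)) / L \<le> g \<bullet> (w - v) / L"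
    using \<open>L > 0\<close> by (intro divide_right_mono) auto
  moreover have "(4 / 5 * \<tau> + (norm g)\<^sup>2 / 2 / (2 * L)) / L
      = 4 * \<tau> / (5 * L) + (norm g)\<^sup>2 / (4 * L\<^sup>2)"
    using \<open>L > 0\<close> by (simp add: field_simps power2_eq_square)
  ultimately show ?thesis
    using \<open>L > 0\<close> by (simp add: norm_diff_step_sq)
qed

section \<open>The algorithm\<close>

text \<open>Induction along the recursion of the loop. \<open>Inv\<close> is a parameter because the
  value bound and the query bound need different invariants; the final disjunction separates the two
  exits.\<close>

lemma agp_loop_invariant:
  fixes w :: "'a::euclidean_space"
  assumes "Inv k w"
    and "\<And>k w. Inv k w \<Longrightarrow> real k < K \<Longrightarrow> 4 * \<epsilon> \<le> norm (orc k w) \<Longrightarrow>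
      Inv (Suc k) (w - (1 / (2 * L)) *\<^sub>R orc k w)"
  shows "(\<forall>q \<in> set (fst (agp_loop L \<epsilon> orc K k w)). \<exists>j. real j < K \<and> Inv j q) \<and>
    (\<exists>j. Inv j (snd (agp_loop L \<epsilon> orc K k w)) \<and>
      (K \<le> real j \<or> norm (orc j (snd (agp_loop L \<epsilon> orc K k w))) < 4 * \<epsilon>))"
  using assms
proof (induction L \<epsilon> orc K k w rule: agp_loop.induct)
  case (1 L \<epsilon> orc K k w)
  show ?case
  proof (cases "real k < K \<and> 4 * \<epsilon> \<le> norm (orc k w)")
    case True
    then have "Inv (Suc k) (w - (1 / (2 * L)) *\<^sub>R orc k w)"
      using "1.prems" by blast
    from "1.IH"[OF _ refl _ this "1.prems"(2)] True "1.prems"(1)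
    show ?thesis
      by (subst (1 2 3) agp_loop.simps) (auto simp: Let_def split_beta)
  next
    case False
    then show ?thesis
      using "1.prems"(1) by (subst (1 2 3) agp_loop.simps) (auto simp: Let_def)
  qed
qed

lemma agp_budget_ge:
  assumes "L > 0" "0 \<le> D" "D \<le> R" "\<epsilon> \<ge> 0" "\<tau> > 0" "5 * \<epsilon> * D \<le> \<tau>"
  shows "5 * L * D\<^sup>2 / (4 * \<tau>) \<le> agp_budget L R \<epsilon> \<tau>"
proof -
  have "5 * L * D\<^sup>2 / (4 * \<tau>) \<le> 5 * L * R\<^sup>2 / (4 * \<tau>)"
    using assms by (intro divide_right_mono mult_left_mono power_mono) auto
  moreover have "5 * L * D\<^sup>2 / (4 * \<tau>) \<le> L * R / (4 * \<epsilon>)" if "\<epsilon> \<noteq> 0"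
  proof -
    \<comment> \<open>Multiplies \<open>D \<le> R\<close> by
      \<open>5 * \<epsilon> * D \<le> \<tau>\<close>.\<close>
    have "L * D * (5 * \<epsilon> * D) \<le> L * R * \<tau>"
      using assms by (intro mult_mono) auto
    then show ?thesis
      using that assms by (simp add: field_simps power2_eq_square)
  qed
  ultimately show ?thesis by (simp add: agp_budget_def)
qed

theorem agp_opt_correct:
  fixes f :: "'a::euclidean_space \<Rightarrow> real"
  assumes "L > 0" "\<epsilon> \<ge> 0" "convex_on UNIV f" "smooth_with L f" "is_arg_min f (\<lambda>_. True) v"
    and "\<tau> > 0" "5 * \<epsilon> * norm v \<le> \<tau>" "agp_oracle \<epsilon> f orc"
    and K: "5 * L * (norm v)\<^sup>2 / (4 * \<tau>) \<le> K"
  shows "f (agp_opt L \<epsilon> orc K) \<le> f v + \<tau>"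
proof -
  have orc: "norm (orc k w - gradient f w) \<le> \<epsilon>" for k w
    using assms(8) by (simp add: agp_oracle_def)
  \<comment> \<open>The distance is guaranteed to shrink only while the gap exceeds
    \<open>\<tau>\<close>. Once the gap is closed, descent keeps it closed, hence the
    disjunction.\<close>
  define Inv where "Inv k w \<longleftrightarrow> f w \<le> f v + \<tau> \<or>
    (norm (w - v))\<^sup>2 \<le> (norm v)\<^sup>2 - real k * (4 * \<tau> / (5 * L))" for k :: nat and w
  \<comment> \<open>While the gap is open, the iterate is no farther from \<open>v\<close> than the
    starting point 0, so the assumption on \<open>norm v\<close> carries over.\<close>
  have dist: "5 * \<epsilon> * norm (w - v) \<le> \<tau>" if "Inv k w" "\<not> f w \<le> f v + \<tau>" for k w
  proof -
    have "0 \<le> real k * (4 * \<tau> / (5 * L))"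
      using assms by simp
    with that have "(norm (w - v))\<^sup>2 \<le> (norm v)\<^sup>2"
      unfolding Inv_def by linarith
    then have "norm (w - v) \<le> norm v"
      by (rule power2_le_imp_le) simp
    then have "5 * \<epsilon> * norm (w - v) \<le> 5 * \<epsilon> * norm v"
      using \<open>\<epsilon> \<ge> 0\<close> by (intro mult_left_mono) auto
    with assms(7) show ?thesis by linarith
  qed
  have step: "Inv (Suc k) (w - (1 / (2 * L)) *\<^sub>R orc k w)"
    if "Inv k w" "4 * \<epsilon> \<le> norm (orc k w)" for k w
  proof (cases "f w \<le> f v + \<tau>")
    case True
    then show ?thesis
      using inexact_step_descent[OF assms(1,4) orc that(2)] by (auto simp: Inv_def)
  next
    case False
    have "(norm (w - (1 / (2 * L)) *\<^sub>R orc k w - v))\<^sup>2 \<le> (norm (w - v))\<^sup>2 - 4 * \<tau> / (5 * L)"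
      using False dist[OF that(1) False]
      by (intro inexact_step_progress[OF assms(1,4,3,5) orc that(2)]) auto
    then show ?thesis
      using that(1) False unfolding Inv_def of_nat_Suc distrib_right by linarith
  qed
  define out where "out = agp_opt L \<epsilon> orc K"
  have "Inv 0 0" by (simp add: Inv_def)
  then obtain j where j: "Inv j out" "K \<le> real j \<or> norm (orc j out) < 4 * \<epsilon>"
    using agp_loop_invariant[of Inv 0 0 K \<epsilon> orc L] step unfolding out_def agp_opt_def by blast
  show ?thesis
  proof (rule ccontr)
    assume "\<not> f (agp_opt L \<epsilon> orc K) \<le> f v + \<tau>"
    then have gap: "\<not> f out \<le> f v + \<tau>" by (simp add: out_def)
    from j(2) show False
    proof
      assume "K \<le> real j"
      \<comment> \<open>This many decreases of \<open>4 * \<tau> / (5 * L)\<close> use up the whole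
        initial squared distance, which forces the output to be \<open>v\<close>.\<close>
      with K have "5 * L * (norm v)\<^sup>2 / (4 * \<tau>) \<le> real j" by linarith
      then have "(norm v)\<^sup>2 \<le> real j * (4 * \<tau> / (5 * L))"
        using assms(1,6) by (simp add: field_simps)
      then have "(norm (out - v))\<^sup>2 \<le> 0"
        using j(1) gap unfolding Inv_def by linarith
      then have "out = v" by simp
      with gap \<open>\<tau> > 0\<close> show False by simp
    next
      assume "norm (orc j out) < 4 * \<epsilon>"
      moreover have "norm (gradient f out) \<le> norm (orc j out) + norm (orc j out - gradient f out)"
        by (metis norm_triangle_sub norm_minus_commute)
      \<comment> \<open>The stopping threshold \<open>4 * \<epsilon>\<close> plus the oracle error
        \<open>\<epsilon>\<close> gives the 5 in the condition on \<open>\<tau>\<close>.\<close>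
      ultimately have "norm (gradient f out) \<le> 5 * \<epsilon>"
        using orc[of j out] by linarith
      have "f out - f v \<le> f out - f v + (norm (gradient f out))\<^sup>2 / (2 * L)"
        using assms(1) by simp
      also have "\<dots> \<le> gradient f out \<bullet> (out - v)"
        by (rule smooth_convex_gap_le[OF assms(1,4,3,5)])
      also have "\<dots> \<le> norm (gradient f out) * norm (out - v)"
        by (rule norm_cauchy_schwarz)
      also have "\<dots> \<le> 5 * \<epsilon> * norm (out - v)"
        using \<open>norm (gradient f out) \<le> 5 * \<epsilon>\<close> by (intro mult_right_mono) auto
      also have "\<dots> \<le> \<tau>"
        using j(1) gap by (rule dist)
      finally show False using gap by simp
    qed
  qed
qed

text \<open>\<open>norm v\<close> counts twice: as the initial distance from 0 to \<open>v\<close>,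
  and in the triangle inequality that passes from \<open>q - v\<close> back to \<open>q\<close>. The
  rest is the accumulated drift.\<close>

theorem agp_queries_norm_le:
  fixes f :: "'a::euclidean_space \<Rightarrow> real"
  assumes "L > 0" "\<epsilon> \<ge> 0" "convex_on UNIV f" "smooth_with L f" "is_arg_min f (\<lambda>_. True) v"
    and "agp_oracle \<epsilon> f orc" "q \<in> agp_queries L \<epsilon> orc K"
  shows "norm q \<le> 2 * norm v + K * (\<epsilon> / (2 * L))"
proof -
  have orc: "norm (orc k w - gradient f w) \<le> \<epsilon>" for k w
    using assms(6) by (simp add: agp_oracle_def)
  define Inv where "Inv k w \<longleftrightarrow> norm (w - v) \<le> norm v + real k * (\<epsilon> / (2 * L))"
    for k :: nat and w
  have "Inv (Suc k) (w - (1 / (2 * L)) *\<^sub>R orc k w)" if "Inv k w" for k w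
    using that inexact_step_dist[OF assms(1,4,3,5) orc, of w k] unfolding Inv_def of_nat_Suc distrib_right
    by linarith
  moreover have "Inv 0 0" by (simp add: Inv_def)
  ultimately obtain j where j: "real j < K" "Inv j q"
    using agp_loop_invariant[of Inv 0 0 K \<epsilon> orc L] assms(7) unfolding agp_queries_def by blast
  have "real j * (\<epsilon> / (2 * L)) \<le> K * (\<epsilon> / (2 * L))"
    using j(1) assms(1,2) by (intro mult_right_mono) auto
  with j(2) norm_triangle_sub[of q v] show ?thesis
    unfolding Inv_def by linarith
qed

theorem theorem3:
  fixes f :: "real ^ 'd \<Rightarrow> real"
    and orc :: "nat \<Rightarrow> real ^ 'd \<Rightarrow> real ^ 'd"
    and L R \<epsilon> \<tau> :: real
  assumes "L > 0" and "R \<ge> 0" and "\<epsilon> \<ge> 0"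
    and "convex_on UNIV f"
    and "smooth_with L f"
    and "\<exists>w. is_arg_min f (\<lambda>_. True) w"
    and "norm (min_norm_minimizer f) \<le> R"
    and "\<tau> > 0"
    and "\<tau> \<ge> 5 * \<epsilon> * norm (min_norm_minimizer f)"
    and "agp_oracle \<epsilon> f orc"
  shows "f (agp_opt L \<epsilon> orc (agp_budget L R \<epsilon> \<tau>)) \<le> f (min_norm_minimizer f) + \<tau> \<and>
         (\<forall>w \<in> agp_queries L \<epsilon> orc (agp_budget L R \<epsilon> \<tau>). norm w \<le> 17 / 8 * R)"
proof (intro conjI ballI)
  have "f differentiable_on UNIV"
    using assms(5) by (simp add: smooth_with_def differentiable_on_def)
  then have min: "is_arg_min f (\<lambda>_. True) (min_norm_minimizer f)"
    using assms(6) by (intro is_arg_min_min_norm_minimizer differentiable_imp_continuous_on)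
  show "f (agp_opt L \<epsilon> orc (agp_budget L R \<epsilon> \<tau>)) \<le> f (min_norm_minimizer f) + \<tau>"
    using assms by (intro agp_opt_correct[OF _ _ _ _ min] agp_budget_ge) auto
  fix w
  assume "w \<in> agp_queries L \<epsilon> orc (agp_budget L R \<epsilon> \<tau>)"
  then have "norm w \<le> 2 * norm (min_norm_minimizer f) + agp_budget L R \<epsilon> \<tau> * (\<epsilon> / (2 * L))"
    by (rule agp_queries_norm_le[OF assms(1,3-5) min assms(10)])
  moreover have "agp_budget L R \<epsilon> \<tau> * (\<epsilon> / (2 * L)) \<le> R / 8"
  \<comment> \<open>Without oracle error the drift vanishes. Otherwise the second term of the budget
    limits it to \<open>R / 8\<close>, and \<open>2 + 1 / 8\<close> is
    \<open>17 / 8\<close>.\<close>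
  proof (cases "\<epsilon> = 0")
    case False
    then have "agp_budget L R \<epsilon> \<tau> * (\<epsilon> / (2 * L)) \<le> L * R / (4 * \<epsilon>) * (\<epsilon> / (2 * L))"
      using assms by (intro mult_right_mono) (auto simp: agp_budget_def)
    also have "\<dots> = R / 8"
      using False assms(1) by simp
    finally show ?thesis .
  qed (use assms in simp)
  ultimately show "norm w \<le> 17 / 8 * R"
    using assms(7) by linarith
qed

end
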